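(* Consider a linear Fokker--Planck--Kolmogorov equation $\partial_t\mu_t=L_t^*\mu_t$. Let $(s,\zeta)\in\mathbb R_+\times\mathcal P$ and $\mu=(\mu_t)_{t\ge s}\in M^{s,\zeta}$. Then $$\#\big(M^{s,\zeta}\cap\mathcal A_{s,\le}(\mu)\big)=1\iff\mu\in M^{s,\zeta}_{\mathrm{ex}}.$$
   Context: $\mathbb R_+=[0,\infty)$; $\mathcal P$ is the set of Borel probability measures on $\mathbb R^d$ with the weak topology; $\#A$ is the cardinality of $A$. The linear equation has Borel coefficients $a_{ij},b_i:\mathbb R_+\times\mathbb R^d\to\mathbb R$, $1\le i,j\le d$, with $a=(a_{ij})=\frac12\sigma\sigma^T$ for a Borel map $\sigma:\mathbb R_+\times\mathbb R^d\to\mathbb R^{d\times d}$, $b=(b_i)$, and $L_t\varphi(x)=a_{ij}(t,x)\partial^2_{ij}\varphi(x)+b_i(t,x)\partial_i\varphi(x)$ (summation convention). A solution from $(s,\zeta)$ is a weakly continuous curve $[s,\infty)\ni t\mapsto\mu_t\in\mathcal P$ with $\int_s^T\int_{\mathbb R^d}|a(t,x)|+|b(t,x)|\,\mu_t(dx)dt<\infty$ for all $T>s$ and $\int\varphi\,d\mu_t-\int\varphi\,d\zeta=\int_s^t\int L_\tau\varphi\,d\mu_\tau\,d\tau$ for all $\varphi\in C^2_c(\mathbb R^d)$, $t\ge s$. $M^{s,\zeta}$ is the (convex) set of all solutions from $(s,\zeta)$, and $M^{s,\zeta}_{\mathrm{ex}}$ the set of its extremal points: $\mu\in M^{s,\zeta}$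 such that $\mu=\alpha\mu^1+(1-\alpha)\mu^2$ with $\alpha\in(0,1)$, $\mu^1,\mu^2\in M^{s,\zeta}$ implies $\mu^1=\mu^2$. For $\mu=(\mu_t)_{t\ge s}$ and $C>0$: $\mathcal A_{s,\le}(\mu,C)=\{(\eta_t)_{t\ge s}\in C([s,\infty),\mathcal P):\eta_t\le C\mu_t\ \forall t\ge s\}$ (inequality of measures), and $\mathcal A_{s,\le}(\mu)=\bigcup_{C>0}\mathcal A_{s,\le}(\mu,C)$. *)

theory Defs
  imports "HOL-Probability.Probability"
begin

definition borel_probs :: "'a::topological_space measure set" where
  "borel_probs = {\<nu>. prob_space \<nu> \<and> sets \<nu> = sets borel}"

text \<open>The coarsest topology on the Borel probability measures that makes the integrals
  of all bounded continuous functions continuous.\<close>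

definition weak_topology :: "'a::topological_space measure topology" where
  "weak_topology = topology_generated_by
     {{\<nu> \<in> borel_probs. (\<integral>x. f x \<partial>\<nu>) \<in> U} | (f :: 'a \<Rightarrow> real) U.
        continuous_on UNIV f \<and> bounded (range f) \<and> open U}"

text \<open>A curve lives on \<open>[s, \<infinity>)\<close> only. Extensionality fixes its values at
  earlier times, so that two curves are equal iff they agree on \<open>[s, \<infinity>)\<close>;
  without it, counting curves would be meaningless.\<close>

definition weak_curves :: "real \<Rightarrow> (real \<Rightarrow> 'a::topological_space measure) set" where
  "weak_curves s = {\<mu> \<in> extensional {s..}. continuous_map (top_of_set {s..}) weak_topology \<mu>}"

lemma topspace_weak_topology [simp]: "topspace weak_topology = borel_probs"
proof -
  let ?S = "{{\<nu> \<in> borel_probs. (\<integral>x. f x \<partial>\<nu>) \<in> U} | (f :: 'a \<Rightarrow> real) U.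
              continuous_on UNIV f \<and> bounded (range f) \<and> open U}"
  have "borel_probs \<in> ?S"
    by (intro CollectI exI[of _ "\<lambda>_. 0"] exI[of _ UNIV]) auto
  then have "\<Union>?S = borel_probs" by blast
  then show ?thesis
    unfolding weak_topology_def topology_generated_by_topspace .
qed

lemma weak_curves_iff:
  fixes \<mu> :: "real \<Rightarrow> 'a::topological_space measure"
  shows "\<mu> \<in> weak_curves s \<longleftrightarrow>
    \<mu> \<in> extensional {s..} \<and> (\<forall>t\<ge>s. \<mu> t \<in> borel_probs) \<and>
    (\<forall>f :: 'a \<Rightarrow> real. continuous_on UNIV f \<longrightarrow> bounded (range f) \<longrightarrow>
        continuous_on {s..} (\<lambda>t. \<integral>x. f x \<partial>\<mu> t))"
proof (cases "\<mu> \<in> extensional {s..} \<and> (\<forall>t\<ge>s. \<mu> t \<in> borel_probs)")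
  case False
  then show ?thesis
    using continuous_map_image_subset_topspace[of "top_of_set {s..}" weak_topology \<mu>]
    unfolding weak_curves_def by auto
next
  case True
  let ?S = "{{\<nu> \<in> borel_probs. (\<integral>x. f x \<partial>\<nu>) \<in> U} | (f :: 'a \<Rightarrow> real) U.
              continuous_on UNIV f \<and> bounded (range f) \<and> open U}"
  have pre: "\<mu> -` {\<nu> \<in> borel_probs. (\<integral>x. f x \<partial>\<nu>) \<in> U} \<inter> {s..} =
        {s..} \<inter> (\<lambda>t. \<integral>x. f x \<partial>\<mu> t) -` U" for f :: "'a \<Rightarrow> real" and U
    using True by auto
  have "\<Union>?S = borel_probs"
    using topspace_weak_topology unfolding weak_topology_def topology_generated_by_topspace .
  then have "\<mu> ` {s..} \<subseteq> \<Union>?S"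
    using True by (simp only:) auto
  then have "continuous_map (top_of_set {s..}) weak_topology \<mu> \<longleftrightarrow>
      (\<forall>V. V \<in> ?S \<longrightarrow> openin (top_of_set {s..}) (\<mu> -` V \<inter> {s..}))"
    unfolding weak_topology_def continuous_on_generated_topo_iff topspace_euclidean_subtopology
    by (simp only: simp_thms)
  also have "\<dots> \<longleftrightarrow> (\<forall>(f :: 'a \<Rightarrow> real) U. continuous_on UNIV f \<longrightarrow> bounded (range f) \<longrightarrow> open U \<longrightarrow>
      openin (top_of_set {s..}) (\<mu> -` {\<nu> \<in> borel_probs. (\<integral>x. f x \<partial>\<nu>) \<in> U} \<inter> {s..}))"
    by blast
  also have "\<dots> \<longleftrightarrow> (\<forall>f :: 'a \<Rightarrow> real. continuous_on UNIV f \<longrightarrow> bounded (range f) \<longrightarrow>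
        continuous_on {s..} (\<lambda>t. \<integral>x. f x \<partial>\<mu> t))"
    unfolding pre continuous_openin_preimage_eq by blast
  finally show ?thesis
    using True unfolding weak_curves_def by auto
qed

definition partial_deriv :: "'n \<Rightarrow> (real^'n \<Rightarrow> real) \<Rightarrow> real^'n \<Rightarrow> real" where
  "partial_deriv i \<phi> x = frechet_derivative \<phi> (at x) (axis i 1)"

definition C2c :: "(real^'n \<Rightarrow> real) set" where
  "C2c = {\<phi>. \<phi> differentiable_on UNIV \<and>
             (\<forall>i. continuous_on UNIV (partial_deriv i \<phi>) \<and> partial_deriv i \<phi> differentiable_on UNIV) \<and>
             (\<forall>i j. continuous_on UNIV (partial_deriv i (partial_deriv j \<phi>))) \<and>
             compact (closure {x. \<phi> x \<noteq> 0})}"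

definition FPK_operator ::
  "(real \<Rightarrow> real^'n \<Rightarrow> real^'n^'n) \<Rightarrow> (real \<Rightarrow> real^'n \<Rightarrow> real^'n) \<Rightarrow>
   real \<Rightarrow> (real^'n \<Rightarrow> real) \<Rightarrow> real^'n \<Rightarrow> real" where
  "FPK_operator a b t \<phi> x =
     (\<Sum>i\<in>UNIV. \<Sum>j\<in>UNIV. a t x $ i $ j * partial_deriv i (partial_deriv j \<phi>) x) +
     (\<Sum>i\<in>UNIV. b t x $ i * partial_deriv i \<phi> x)"

definition FPK_solutions ::
  "(real \<Rightarrow> real^'n \<Rightarrow> real^'n^'n) \<Rightarrow> (real \<Rightarrow> real^'n \<Rightarrow> real^'n) \<Rightarrow>
   real \<Rightarrow> (real^'n) measure \<Rightarrow> (real \<Rightarrow> (real^'n) measure) set" where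
  "FPK_solutions a b s \<zeta> = {\<mu> \<in> weak_curves s.
     (\<forall>T>s. (\<integral>\<^sup>+t\<in>{s..T}. (\<integral>\<^sup>+x. ennreal (norm (a t x) + norm (b t x)) \<partial>\<mu> t) \<partial>lborel) < \<infinity>) \<and>
     (\<forall>\<phi>\<in>C2c. \<forall>t\<ge>s. (\<integral>x. \<phi> x \<partial>\<mu> t) - (\<integral>x. \<phi> x \<partial>\<zeta>) =
        (LINT \<tau>:{s..t}|lborel. (\<integral>x. FPK_operator a b \<tau> \<phi> x \<partial>\<mu> \<tau>)))}"

definition curve_convex_comb ::
  "real \<Rightarrow> real \<Rightarrow> (real \<Rightarrow> 'a::topological_space measure) \<Rightarrow> (real \<Rightarrow> 'a measure) \<Rightarrow>
   (real \<Rightarrow> 'a measure) \<Rightarrow> bool" where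
  "curve_convex_comb s \<alpha> \<mu>1 \<mu>2 \<mu> \<longleftrightarrow>
     (\<forall>t\<ge>s. \<forall>A\<in>sets borel. measure (\<mu> t) A = \<alpha> * measure (\<mu>1 t) A + (1 - \<alpha>) * measure (\<mu>2 t) A)"

definition FPK_extremal ::
  "(real \<Rightarrow> real^'n \<Rightarrow> real^'n^'n) \<Rightarrow> (real \<Rightarrow> real^'n \<Rightarrow> real^'n) \<Rightarrow>
   real \<Rightarrow> (real^'n) measure \<Rightarrow> (real \<Rightarrow> (real^'n) measure) set" where
  "FPK_extremal a b s \<zeta> = {\<mu> \<in> FPK_solutions a b s \<zeta>.
     \<forall>\<alpha>\<in>{0<..<1}. \<forall>\<mu>1\<in>FPK_solutions a b s \<zeta>. \<forall>\<mu>2\<in>FPK_solutions a b s \<zeta>.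
       curve_convex_comb s \<alpha> \<mu>1 \<mu>2 \<mu> \<longrightarrow> \<mu>1 = \<mu>2}"

text \<open>The order on \<^typ>\<open>'a measure\<close> is lexicographic in space, sigma-algebra and
  values; between measures with the same measurable sets, as here, it is the setwise order.\<close>

definition dominated_by ::
  "real \<Rightarrow> (real \<Rightarrow> 'a::topological_space measure) \<Rightarrow> real \<Rightarrow> (real \<Rightarrow> 'a measure) set" where
  "dominated_by s \<mu> C = {\<eta> \<in> weak_curves s. \<forall>t\<ge>s. \<eta> t \<le> scale_measure (ennreal C) (\<mu> t)}"

definition dominated :: "real \<Rightarrow> (real \<Rightarrow> 'a::topological_space measure) \<Rightarrow> (real \<Rightarrow> 'a measure) set" where
  "dominated s \<mu> = (\<Union>C\<in>{0<..}. dominated_by s \<mu> C)"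

end

theory Submission
  imports Defs
begin

text \<open>If \<open>\<mu> = \<alpha>\<mu>1 + (1 - \<alpha>)\<mu>2\<close> splits \<open>\<mu>\<close> into two solutions, then \<open>\<mu>1 \<le> \<mu> / \<alpha>\<close> and
  \<open>\<mu>2 \<le> \<mu> / (1 - \<alpha>)\<close>; so both lie in the set that is counted, and if this set has one
  element, they agree. Conversely, let \<open>\<mu>\<close> be extremal and \<open>\<eta> \<le> C\<mu>\<close> a solution with \<open>C > 1\<close>.
  Then \<open>\<nu> = (\<mu> - \<eta> / C) / (1 - 1 / C)\<close> is a curve of probability measures with
  \<open>\<mu> = \<eta> / C + (1 - 1 / C)\<nu>\<close>. If \<open>\<nu>\<close> is a solution, then extremality gives \<open>\<eta> = \<nu>\<close>,
  and hence \<open>\<eta> = \<mu>\<close>. Since \<open>\<mu>\<close> dominates itself, it is the only solution that it dominates.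

  That \<open>\<nu>\<close> is a solution (\<open>FPK_solution_remainder\<close>) holds because the equation is linear, but
  subtracting the equations of \<open>\<mu>\<close> and \<open>\<eta>\<close> requires their integrals to exist. In space this
  holds for almost every time, since the operator applied to a test function is bounded by a
  multiple of the norms of the coefficients (\<open>FPK_operator_bound\<close>). In time it requires
  measurability of the spatial integrals, which holds because a weakly continuous curve is a
  measurable kernel (\<open>weak_curve_measurable\<close>).\<close>

section \<open>Mixtures of two measures\<close>

lemma borel_measurable_sets_eq:
  "sets N = sets M \<Longrightarrow> f \<in> borel_measurable M \<Longrightarrow> f \<in> borel_measurable N"
  using measurable_cong_sets[of N M borel borel] by simp

text \<open>The identity is assumed for indicator functions, and both sides are additive, homogeneous
  and continuous along increasing sequences, so it extends to all nonnegative measurable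
  functions.\<close>

lemma nn_integral_linear_in_measure:
  assumes sets [simp]: "sets N1 = sets M" "sets N2 = sets M"
    and comb: "\<And>A. A \<in> sets M \<Longrightarrow> emeasure M A = p * emeasure N1 A + q * emeasure N2 A"
    and f: "f \<in> borel_measurable M"
  shows "(\<integral>\<^sup>+x. f x \<partial>M) = p * (\<integral>\<^sup>+x. f x \<partial>N1) + q * (\<integral>\<^sup>+x. f x \<partial>N2)"
  using f
proof (induction rule: borel_measurable_induct)
  case (cong f g)
  have [simp]: "space N1 = space M" "space N2 = space M"
    by (auto intro!: sets_eq_imp_space_eq)
  have "integral\<^sup>N K f = integral\<^sup>N K g" if "space K = space M" for K
    by (rule nn_integral_cong) (simp add: that cong)
  then show ?case using cong by simp
next
  case (set A)
  then show ?case by (simp add: comb)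
next
  case (mult u c)
  have [measurable]: "u \<in> borel_measurable N1" "u \<in> borel_measurable N2" "u \<in> borel_measurable M"
    using mult(2) by (auto intro: borel_measurable_sets_eq[of _ M])
  show ?case
    by (simp add: nn_integral_cmult mult algebra_simps)
next
  case (add u v)
  have [measurable]: "u \<in> borel_measurable N1" "u \<in> borel_measurable N2" "u \<in> borel_measurable M"
    "v \<in> borel_measurable N1" "v \<in> borel_measurable N2" "v \<in> borel_measurable M"
    using add(1,3) by (auto intro: borel_measurable_sets_eq[of _ M])
  show ?case
    by (simp add: nn_integral_add add algebra_simps)
next
  case (seq U)
  have inc: "incseq (\<lambda>i. integral\<^sup>N K (U i))" for K
    using seq by (auto simp: incseq_def le_fun_def intro!: nn_integral_mono)
  have sup: "(\<integral>\<^sup>+x. (SUP i. U i) x \<partial>K) = (SUP i. integral\<^sup>N K (U i))"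
    if "sets K = sets M" for K
  proof -
    have "(\<integral>\<^sup>+x. (SUP i. U i x) \<partial>K) = (SUP i. integral\<^sup>N K (U i))"
      using seq that by (intro nn_integral_monotone_convergence_SUP) (auto intro: borel_measurable_sets_eq[of _ M])
    then show ?thesis by (simp add: image_comp)
  qed
  have "(SUP i. integral\<^sup>N M (U i)) = (SUP i. p * integral\<^sup>N N1 (U i) + q * integral\<^sup>N N2 (U i))"
    using seq by simp
  also have "\<dots> = (SUP i. p * integral\<^sup>N N1 (U i)) + (SUP i. q * integral\<^sup>N N2 (U i))"
    using inc by (intro ennreal_SUP_add) (auto simp: incseq_def intro!: mult_left_mono)
  also have "\<dots> = p * (SUP i. integral\<^sup>N N1 (U i)) + q * (SUP i. integral\<^sup>N N2 (U i))"
    by (simp add: SUP_mult_left_ennreal)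
  finally show ?case by (simp only: sup[OF refl] sup[OF sets(1)] sup[OF sets(2)])
qed

text \<open>Stated in \<^typ>\<open>ennreal\<close> and on the sets of \<open>M\<close>, so that it feeds directly into
  nonnegative integrals.\<close>

definition mixture :: "real \<Rightarrow> 'a measure \<Rightarrow> 'a measure \<Rightarrow> 'a measure \<Rightarrow> bool" where
  "mixture \<alpha> N1 N2 M \<longleftrightarrow>
     0 < \<alpha> \<and> \<alpha> < 1 \<and> sets N1 = sets M \<and> sets N2 = sets M \<and>
     (\<forall>A\<in>sets M. emeasure M A = ennreal \<alpha> * emeasure N1 A + ennreal (1 - \<alpha>) * emeasure N2 A)"

lemma nn_integral_mixture:
  assumes "mixture \<alpha> N1 N2 M" "f \<in> borel_measurable M"
  shows "(\<integral>\<^sup>+x. f x \<partial>M) = ennreal \<alpha> * (\<integral>\<^sup>+x. f x \<partial>N1) + ennreal (1 - \<alpha>) * (\<integral>\<^sup>+x. f x \<partial>N2)"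
  using assms unfolding mixture_def by (intro nn_integral_linear_in_measure) auto

text \<open>Both weights are positive, so finiteness of an integral against the mixture forces
  finiteness against each component.\<close>

lemma integral_mixture:
  fixes f :: "'a \<Rightarrow> real"
  assumes mix: "mixture \<alpha> N1 N2 M" and f: "integrable M f"
  shows "integrable N1 f" "integrable N2 f"
    and "integral\<^sup>L M f = \<alpha> * integral\<^sup>L N1 f + (1 - \<alpha>) * integral\<^sup>L N2 f"
proof -
  have \<alpha>: "0 < \<alpha>" "\<alpha> < 1" and [simp]: "sets N1 = sets M" "sets N2 = sets M"
    using mix by (auto simp: mixture_def)
  have fm [measurable]: "f \<in> borel_measurable M" using f by simp
  have meas: "f \<in> borel_measurable N1" "f \<in> borel_measurable N2"
    using fm by (auto intro: borel_measurable_sets_eq[of _ M])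
  have comb: "(\<integral>\<^sup>+x. ennreal (g x) \<partial>M) =
      ennreal \<alpha> * (\<integral>\<^sup>+x. ennreal (g x) \<partial>N1) + ennreal (1 - \<alpha>) * (\<integral>\<^sup>+x. ennreal (g x) \<partial>N2)"
    if "g \<in> borel_measurable M" for g
    using that by (intro nn_integral_mixture[OF mix]) simp
  have fin: "(\<integral>\<^sup>+x. ennreal (g x) \<partial>N1) < \<infinity> \<and> (\<integral>\<^sup>+x. ennreal (g x) \<partial>N2) < \<infinity>"
    if "g \<in> borel_measurable M" "(\<integral>\<^sup>+x. ennreal (g x) \<partial>M) < \<infinity>" for g
    using that(2) \<alpha> unfolding comb[OF that(1)]
    by (auto simp: ennreal_mult_less_top less_top[symmetric] ennreal_mult_eq_top_iff)
  have pos: "(\<integral>\<^sup>+x. ennreal (f x) \<partial>M) < \<infinity>" and neg: "(\<integral>\<^sup>+x. ennreal (- f x) \<partial>M) < \<infinity>"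
    using f by (simp_all add: real_integrable_def less_top)
  note fin_pos = fin[OF fm pos] and fin_neg = fin[OF _ neg, simplified]
  show int: "integrable N1 f" "integrable N2 f"
    using fin_pos fin_neg meas by (auto simp: real_integrable_def)
  have *: "enn2real (ennreal p * A + ennreal q * B) = p * enn2real A + q * enn2real B"
    if "A < \<infinity>" "B < \<infinity>" "0 < p" "0 < q" for p q A B
    using that by (simp add: enn2real_plus ennreal_mult_less_top enn2real_mult)
  show "integral\<^sup>L M f = \<alpha> * integral\<^sup>L N1 f + (1 - \<alpha>) * integral\<^sup>L N2 f"
    unfolding real_lebesgue_integral_def[OF f] real_lebesgue_integral_def[OF int(1)]
      real_lebesgue_integral_def[OF int(2)]
    using fin_pos fin_neg \<alpha> by (simp add: comb * algebra_simps)
qed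

lemma measure_mixture:
  assumes mix: "mixture \<alpha> N1 N2 M" and M: "finite_measure M" and A: "A \<in> sets M"
  shows "measure M A = \<alpha> * measure N1 A + (1 - \<alpha>) * measure N2 A"
proof -
  interpret finite_measure M by fact
  have "A \<in> sets N1" "A \<in> sets N2" using mix A by (auto simp: mixture_def)
  moreover have "integrable M (indicat_real A)" using A by (simp add: less_top[symmetric])
  ultimately show ?thesis
    using integral_mixture(3)[OF mix, of "indicator A"] A by simp
qed

text \<open>The remainder is \<open>R = (M - N / C) / (1 - 1 / C)\<close>: domination makes the numerator
  nonnegative, and \<open>C > 1\<close> makes the denominator positive.\<close>

lemma mixture_remainder_exists:
  assumes M: "prob_space M" and N: "prob_space N" and sets: "sets N = sets M"
    and C: "1 < C" and le: "\<And>A. A \<in> sets M \<Longrightarrow> emeasure N A \<le> ennreal C * emeasure M A"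
  obtains R where "prob_space R" "mixture (1 / C) N R M"
proof -
  interpret M: prob_space M by fact
  interpret N: prob_space N by fact
  have le': "emeasure (scale_measure (ennreal (1 / C)) N) A \<le> emeasure M A" if "A \<in> sets M" for A
  proof -
    have "ennreal (1 / C) * emeasure N A \<le> ennreal (1 / C) * (ennreal C * emeasure M A)"
      using le[OF that] by (rule mult_left_mono) simp
    also have "\<dots> = emeasure M A"
      using C by (simp add: mult.assoc[symmetric] ennreal_mult[symmetric])
    finally show ?thesis by simp
  qed
  define D where "D = diff_measure M (scale_measure (ennreal (1 / C)) N)"
  define R where "R = scale_measure (ennreal (1 / (1 - 1 / C))) D"
  have c: "0 < 1 - 1 / C" using C by simp
  have D: "emeasure D A = emeasure M A - ennreal (1 / C) * emeasure N A" if "A \<in> sets M" for A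
    unfolding D_def using that le' sets
    by (subst emeasure_diff_measure)
       (auto intro!: finite_measureI M.finite_measure_axioms simp: ennreal_mult_less_top ennreal_mult_eq_top_iff)
  have [simp]: "sets R = sets M" "space R = space M" "space D = space M" by (simp_all add: R_def D_def space_scale_measure)
  have scale: "ennreal (1 - 1 / C) * emeasure R A = emeasure D A" for A
    using c C by (simp add: R_def mult.assoc[symmetric] ennreal_mult[symmetric])
  have mix: "mixture (1 / C) N R M"
    unfolding mixture_def
  proof (intro conjI ballI)
    fix A assume A: "A \<in> sets M"
    show "emeasure M A = ennreal (1 / C) * emeasure N A + ennreal (1 - 1 / C) * emeasure R A"
      unfolding scale D[OF A]
      using diff_add_cancel_ennreal[OF le'[OF A]] by (metis add.commute emeasure_scale_measure)
  qed (use C sets in auto)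
  have sp: "space N = space M" using sets by (rule sets_eq_imp_space_eq)
  have "emeasure R (space R) = 1"
    using c D[OF sets.top] M.emeasure_space_1 N.emeasure_space_1 C sp
    by (simp add: R_def ennreal_1[symmetric] ennreal_minus ennreal_mult[symmetric] space_scale_measure del: ennreal_1)
  then have "prob_space R" by (rule prob_spaceI)
  then show thesis using mix that by blast
qed

section \<open>Weakly continuous curves as measurable kernels\<close>

text \<open>Dominated convergence: the functions decrease to the indicator of \<open>A\<close>, because a point
  outside a closed set has positive distance from it. The empty set is left out, as there
  \<^const>\<open>infdist\<close> has the default value \<open>0\<close>.\<close>

lemma measure_closed_as_limit:
  fixes A :: "'a::metric_space set"
  assumes "prob_space M" "sets M = sets borel" and A: "closed A" "A \<noteq> {}"
  shows "(\<lambda>n. \<integral>x. max 0 (1 - real n * infdist x A) \<partial>M) \<longlonglongrightarrow> measure M A"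
proof -
  interpret prob_space M by fact
  have [measurable_cong]: "sets M = sets borel" by fact
  have [measurable]: "A \<in> sets borel" using A by simp
  have sp: "space M = UNIV" using sets_eq_imp_space_eq[OF assms(2)] by simp
  have [measurable]: "(\<lambda>x. infdist x A) \<in> borel_measurable borel"
    by (intro borel_measurable_continuous_onI continuous_on_infdist continuous_on_id)
  have lim: "(\<lambda>n. max 0 (1 - real n * infdist x A)) \<longlonglongrightarrow> indicat_real A x" for x
  proof (cases "x \<in> A")
    case False
    then have pos: "0 < infdist x A"
      using A by (metis infdist_nonneg in_closed_iff_infdist_zero less_eq_real_def)
    \<comment> \<open>The sequence is eventually constant: \<open>n * infdist x A\<close> exceeds \<open>1\<close>.\<close>
    have "\<forall>\<^sub>F n in sequentially. 1 / infdist x A < real n"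
      using filterlim_real_sequentially by (simp add: filterlim_at_top_dense)
    then have "\<forall>\<^sub>F n in sequentially. max 0 (1 - real n * infdist x A) = 0"
      by eventually_elim (use pos in \<open>simp add: field_simps\<close>)
    then show ?thesis using False by (simp add: tendsto_eventually)
  qed simp
  have "(\<lambda>n. \<integral>x. max 0 (1 - real n * infdist x A) \<partial>M) \<longlonglongrightarrow> (\<integral>x. indicator A x \<partial>M)"
    using lim by (intro integral_dominated_convergence[where w="\<lambda>_. 1"])
      (auto simp: infdist_nonneg)
  then show ?thesis by (simp add: sp)
qed

text \<open>A weakly continuous curve is a measurable kernel in time. Closed sets generate the Borel
  sets and are stable under intersection, and the measure of a closed set is a pointwise limit of
  integrals of bounded continuous functions, each of which is continuous in time.\<close>

lemma weak_curve_measurable: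
  fixes \<mu> :: "real \<Rightarrow> 'a::metric_space measure"
  assumes \<mu>: "\<mu> \<in> weak_curves s"
  shows "\<mu> \<in> measurable (restrict_space borel {s..}) (subprob_algebra borel)"
proof (rule measurable_prob_algebraD, rule measurable_prob_algebra_generated[where \<Omega>=UNIV and G="Collect closed"])
  have prob: "prob_space (\<mu> t)" "sets (\<mu> t) = sets borel" if "t \<ge> s" for t
    using \<mu> that by (auto simp: weak_curves_iff borel_probs_def)
  show "sets (borel :: 'a measure) = sigma_sets UNIV (Collect closed)"
    unfolding borel_eq_closed by simp
  show "Int_stable (Collect closed :: 'a set set)" by (auto simp: Int_stable_def)
  fix A :: "'a set" assume "A \<in> Collect closed"
  then have A: "closed A" by simp
  show "(\<lambda>t. emeasure (\<mu> t) A) \<in> borel_measurable (restrict_space borel {s..})"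
  proof (cases "A = {}")
    case False
    let ?f = "\<lambda>n x. max 0 (1 - real n * infdist x A)"
    have "(\<lambda>t. measure (\<mu> t) A) \<in> borel_measurable (restrict_space borel {s..})"
    proof (rule borel_measurable_LIMSEQ_metric)
      show "(\<lambda>t. \<integral>x. ?f n x \<partial>\<mu> t) \<in> borel_measurable (restrict_space borel {s..})" for n
      proof (rule borel_measurable_continuous_on_restrict)
        have "continuous_on UNIV (?f n)" by (intro continuous_intros)
        moreover have "bounded (range (?f n))"
          by (rule boundedI[of _ 1]) (auto simp: infdist_nonneg)
        ultimately show "continuous_on {s..} (\<lambda>t. \<integral>x. ?f n x \<partial>\<mu> t)"
          using \<mu> by (auto simp: weak_curves_iff)
      qed
      show "(\<lambda>n. \<integral>x. ?f n x \<partial>\<mu> t) \<longlonglongrightarrow> measure (\<mu> t) A" if "t \<in> space (restrict_space borel {s..})" for t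
        using that A False by (intro measure_closed_as_limit prob) (auto simp: space_restrict_space)
    qed
    then have "(\<lambda>t. ennreal (measure (\<mu> t) A)) \<in> borel_measurable (restrict_space borel {s..})" by simp
    moreover have "ennreal (measure (\<mu> t) A) = emeasure (\<mu> t) A" if "t \<in> space (restrict_space borel {s..})" for t
    proof -
      interpret prob_space "\<mu> t" using that prob by (auto simp: space_restrict_space)
      show ?thesis by (simp add: emeasure_eq_measure)
    qed
    ultimately show ?thesis by (subst (asm) measurable_cong)
  qed simp
qed (use \<mu> in \<open>auto simp: weak_curves_iff borel_probs_def space_restrict_space\<close>)

text \<open>The Bochner integral takes the default value \<open>0\<close> at non-integrable functions, so it is
  written as a difference of nonnegative integrals only where both parts are finite.\<close>

lemma integral_kernel_measurable:
  fixes f :: "'a \<Rightarrow> 'b \<Rightarrow> real"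
  assumes f [measurable]: "(\<lambda>(x, y). f x y) \<in> borel_measurable (M \<Otimes>\<^sub>M N)"
    and K [measurable]: "K \<in> measurable M (subprob_algebra N)"
  shows "(\<lambda>x. \<integral>y. f x y \<partial>K x) \<in> borel_measurable M"
proof -
  note [measurable] = nn_integral_measurable_subprob_algebra2
  let ?g = "\<lambda>x. if (\<integral>\<^sup>+y. ennreal (f x y) \<partial>K x) \<noteq> \<infinity> \<and> (\<integral>\<^sup>+y. ennreal (- f x y) \<partial>K x) \<noteq> \<infinity>
    then enn2real (\<integral>\<^sup>+y. ennreal (f x y) \<partial>K x) - enn2real (\<integral>\<^sup>+y. ennreal (- f x y) \<partial>K x) else 0"
  have "?g \<in> borel_measurable M" by measurable
  moreover have "?g x = (\<integral>y. f x y \<partial>K x)" if x: "x \<in> space M" for x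
  proof -
    have "sets (K x) = sets N" using K x by (rule sets_kernel)
    moreover have "f x \<in> borel_measurable N"
      using measurable_Pair2[OF f x] by simp
    ultimately have "f x \<in> borel_measurable (K x)" by (rule borel_measurable_sets_eq)
    then show ?thesis
      by (auto simp: real_integrable_def real_lebesgue_integral_def not_integrable_integral_eq)
  qed
  ultimately show ?thesis by (subst (asm) measurable_cong)
qed

section \<open>Integrability of the operator along a curve\<close>

lemma partial_deriv_outside_support:
  assumes S: "closed S" and f: "\<And>x. x \<notin> S \<Longrightarrow> f x = 0" and x: "x \<notin> S"
  shows "partial_deriv i f x = 0"
proof -
  have "(f has_derivative (\<lambda>_. 0)) (at x)"
    by (rule has_derivative_transform_within_open[of "\<lambda>_. 0" _ _ _ "- S"]) (use S f x in auto)
  then show ?thesis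
    unfolding partial_deriv_def by (metis frechet_derivative_at)
qed

lemma bounded_of_compact_support:
  fixes f :: "'a::topological_space \<Rightarrow> real"
  assumes "continuous_on UNIV f" "compact S" "\<And>x. x \<notin> S \<Longrightarrow> f x = 0"
  obtains B where "B \<ge> 0" "\<And>x. \<bar>f x\<bar> \<le> B"
proof -
  have "bounded (f ` S)"
    using assms by (intro compact_imp_bounded compact_continuous_image) (auto intro: continuous_on_subset)
  then obtain B where "B > 0" "\<forall>y\<in>f ` S. norm y \<le> B"
    by (auto simp: bounded_pos)
  then show thesis using assms(3) by (intro that[of B]) (force, metis abs_zero image_eqI less_imp_le real_norm_def)
qed

text \<open>The derivatives of a test function vanish off its support, so they are continuous
  functions with compact support.\<close>

lemma C2c_bounded_derivatives:
  fixes \<phi> :: "real^'n \<Rightarrow> real"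
  assumes "\<phi> \<in> C2c"
  obtains B where "B \<ge> 0" "\<And>x. \<bar>\<phi> x\<bar> \<le> B" "\<And>i x. \<bar>partial_deriv i \<phi> x\<bar> \<le> B"
    "\<And>i j x. \<bar>partial_deriv i (partial_deriv j \<phi>) x\<bar> \<le> B"
proof -
  let ?S = "closure {x. \<phi> x \<noteq> 0}"
  have cont: "continuous_on UNIV \<phi>" "continuous_on UNIV (partial_deriv i \<phi>)"
    "continuous_on UNIV (partial_deriv i (partial_deriv j \<phi>))" and S: "compact ?S" for i j
    using assms by (auto simp: C2c_def intro: differentiable_imp_continuous_on)
  have z0: "\<phi> x = 0" if "x \<notin> ?S" for x
    using that closure_subset[of "{x. \<phi> x \<noteq> 0}"] by auto
  have z1: "partial_deriv i \<phi> x = 0" if "x \<notin> ?S" for i x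
    using partial_deriv_outside_support[of ?S \<phi>] z0 that by blast
  have z2: "partial_deriv i (partial_deriv j \<phi>) x = 0" if "x \<notin> ?S" for i j x
    using partial_deriv_outside_support[of ?S "partial_deriv j \<phi>"] z1 that by blast
  obtain B0 where B0: "B0 \<ge> 0" "\<And>x. \<bar>\<phi> x\<bar> \<le> B0"
    using bounded_of_compact_support[OF cont(1) S z0] by blast
  have "\<forall>i. \<exists>B\<ge>0. \<forall>x. \<bar>partial_deriv i \<phi> x\<bar> \<le> B"
    using bounded_of_compact_support[OF cont(2) S z1] by metis
  then obtain B1 where B1: "\<And>i. B1 i \<ge> 0" "\<And>i x. \<bar>partial_deriv i \<phi> x\<bar> \<le> B1 i"
    by metis
  have "\<forall>i j. \<exists>B\<ge>0. \<forall>x. \<bar>partial_deriv i (partial_deriv j \<phi>) x\<bar> \<le> B"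
    using bounded_of_compact_support[OF cont(3) S z2] by metis
  then obtain B2 where B2: "\<And>i j. B2 i j \<ge> 0" "\<And>i j x. \<bar>partial_deriv i (partial_deriv j \<phi>) x\<bar> \<le> B2 i j"
    by metis
  let ?B1 = "\<Sum>i\<in>UNIV. B1 i" and ?B2 = "\<Sum>i\<in>UNIV. \<Sum>j\<in>UNIV. B2 i j"
  have nonneg: "?B1 \<ge> 0" "?B2 \<ge> 0" by (simp_all add: sum_nonneg B1 B2)
  have le1: "B1 i \<le> ?B1" for i
    by (rule member_le_sum) (use B1 in auto)
  have le2: "B2 i j \<le> ?B2" for i j
  proof -
    have "B2 i j \<le> (\<Sum>j\<in>UNIV. B2 i j)" by (rule member_le_sum) (use B2 in auto)
    also have "\<dots> \<le> ?B2"
      by (rule member_le_sum[of i UNIV "\<lambda>i. \<Sum>j\<in>UNIV. B2 i j"]) (auto intro: sum_nonneg B2)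
    finally show ?thesis .
  qed
  show thesis
  proof (rule that[of "B0 + ?B1 + ?B2"])
    show "0 \<le> B0 + ?B1 + ?B2" using B0 nonneg by linarith
    show "\<bar>\<phi> x\<bar> \<le> B0 + ?B1 + ?B2" for x using B0(2)[of x] nonneg by linarith
    show "\<bar>partial_deriv i \<phi> x\<bar> \<le> B0 + ?B1 + ?B2" for i x
      using B0(1) B1(2)[of i x] le1[of i] nonneg by linarith
    show "\<bar>partial_deriv i (partial_deriv j \<phi>) x\<bar> \<le> B0 + ?B1 + ?B2" for i j x
      using B0(1) B2(2)[of i j x] le2[of i j] nonneg by linarith
  qed
qed

text \<open>This is what turns the integrability condition on the coefficients, which does not mention
  test functions, into integrability of \<open>FPK_operator a b t \<phi>\<close>. The constant depends only
  on \<open>\<phi>\<close>.\<close>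

lemma FPK_operator_bound:
  fixes \<phi> :: "real^'n \<Rightarrow> real"
  assumes "\<phi> \<in> C2c"
  obtains K where "K \<ge> 0" "\<And>a b t x. \<bar>FPK_operator a b t \<phi> x\<bar> \<le> K * (norm (a t x) + norm (b t x))"
proof -
  obtain B where B: "B \<ge> 0" "\<And>i x. \<bar>partial_deriv i \<phi> x\<bar> \<le> B"
    "\<And>i j x. \<bar>partial_deriv i (partial_deriv j \<phi>) x\<bar> \<le> B"
    using C2c_bounded_derivatives[OF assms] by metis
  let ?d = "real CARD('n)"
  have "\<bar>FPK_operator a b t \<phi> x\<bar> \<le> (?d * ?d * B + ?d * B) * (norm (a t x) + norm (b t x))" for a b t x
  proof -
    have entry: "\<bar>a t x $ i $ j\<bar> \<le> norm (a t x)" for i j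
      using component_le_norm_cart[of "a t x $ i" j] Finite_Cartesian_Product.norm_nth_le[of "a t x" i] by linarith
    have "\<bar>\<Sum>i\<in>UNIV. \<Sum>j\<in>UNIV. a t x $ i $ j * partial_deriv i (partial_deriv j \<phi>) x\<bar>
        \<le> (\<Sum>i\<in>(UNIV::'n set). \<Sum>j\<in>(UNIV::'n set). norm (a t x) * B)"
      by (intro order_trans[OF sum_abs] sum_mono) (auto simp: abs_mult intro!: mult_mono entry B)
    moreover have "\<bar>\<Sum>i\<in>UNIV. b t x $ i * partial_deriv i \<phi> x\<bar> \<le> (\<Sum>i\<in>(UNIV::'n set). norm (b t x) * B)"
      by (intro order_trans[OF sum_abs] sum_mono)
        (auto simp: abs_mult intro!: mult_mono component_le_norm_cart B)
    ultimately have "\<bar>FPK_operator a b t \<phi> x\<bar> \<le> ?d * ?d * B * norm (a t x) + ?d * B * norm (b t x)"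
      unfolding FPK_operator_def by (simp add: algebra_simps)
    also have "\<dots> \<le> (?d * ?d * B + ?d * B) * (norm (a t x) + norm (b t x))"
      using B(1) by (simp add: algebra_simps)
    finally show ?thesis .
  qed
  then show thesis using B(1) by (intro that[of "?d * ?d * B + ?d * B"]) auto
qed

text \<open>The coefficients are measurable on a restriction of the Borel space of pairs, whereas
  integration against a kernel needs a product with the restricted time axis.\<close>

lemma measurable_on_time_strip:
  fixes f :: "real \<Rightarrow> 'a::euclidean_space \<Rightarrow> 'b::topological_space"
  assumes f: "(\<lambda>(t, x). f t x) \<in> borel_measurable (restrict_space borel ({0..} \<times> UNIV))" and s: "s \<ge> 0"
  shows "(\<lambda>(t, x). f t x) \<in> borel_measurable (restrict_space borel {s..} \<Otimes>\<^sub>M borel)"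
proof -
  have "(\<lambda>z. z) \<in> measurable (restrict_space borel {s..} \<Otimes>\<^sub>M (borel :: 'a measure)) (restrict_space borel ({0..} \<times> UNIV))"
  proof (rule measurable_restrict_space2)
    have "fst \<in> measurable (restrict_space borel {s..} \<Otimes>\<^sub>M (borel :: 'a measure)) (borel :: real measure)"
      by (rule measurable_compose[OF measurable_fst]) (rule measurable_restrict_space1, simp)
    then have "(\<lambda>z. (fst z, snd z)) \<in> measurable (restrict_space borel {s..} \<Otimes>\<^sub>M borel) (borel \<Otimes>\<^sub>M (borel :: 'a measure))"
      by (intro measurable_Pair measurable_snd)
    then show "(\<lambda>z. z) \<in> measurable (restrict_space borel {s..} \<Otimes>\<^sub>M (borel :: 'a measure)) (borel :: (real \<times> 'a) measure)"
      unfolding borel_prod by simp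
  qed (use s in \<open>auto simp: space_pair_measure space_restrict_space\<close>)
  from measurable_compose[OF this f] show ?thesis by simp
qed

lemma FPK_operator_measurable:
  fixes a :: "real \<Rightarrow> real^'n \<Rightarrow> real^'n^'n" and b :: "real \<Rightarrow> real^'n \<Rightarrow> real^'n"
  assumes a [measurable]: "(\<lambda>(t, x). a t x) \<in> borel_measurable (M \<Otimes>\<^sub>M borel)"
    and b [measurable]: "(\<lambda>(t, x). b t x) \<in> borel_measurable (M \<Otimes>\<^sub>M borel)"
    and \<phi>: "\<phi> \<in> C2c"
  shows "(\<lambda>(t, x). FPK_operator a b t \<phi> x) \<in> borel_measurable (M \<Otimes>\<^sub>M borel)"
proof -
  have "(\<lambda>v :: real^'n^'n. v $ i $ j) \<in> borel_measurable borel" for i j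
    by (intro borel_measurable_continuous_onI continuous_intros)
  from measurable_compose[OF a this]
  have [measurable]: "(\<lambda>z. a (fst z) (snd z) $ i $ j) \<in> borel_measurable (M \<Otimes>\<^sub>M borel)" for i j
    by (simp add: case_prod_beta)
  have "(\<lambda>v :: real^'n. v $ i) \<in> borel_measurable borel" for i
    by (intro borel_measurable_continuous_onI continuous_intros)
  from measurable_compose[OF b this]
  have [measurable]: "(\<lambda>z. b (fst z) (snd z) $ i) \<in> borel_measurable (M \<Otimes>\<^sub>M borel)" for i
    by (simp add: case_prod_beta)
  have [measurable]: "partial_deriv i \<phi> \<in> borel_measurable borel"
    "partial_deriv i (partial_deriv j \<phi>) \<in> borel_measurable borel" for i j
    using \<phi> by (auto simp: C2c_def intro!: borel_measurable_continuous_onI)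
  show ?thesis
    unfolding FPK_operator_def case_prod_beta by measurable
qed

text \<open>The inner integrals of \<open>FPK_operator a b \<tau> \<phi>\<close> have a genuine value only where the
  operator is integrable, which holds for almost every time; and the outer integral
  is linear in the curve only if the inner one is integrable in time. These two facts, needed
  to subtract the equations of two solutions, follow from the bound on the operator and from the
  measurability of the curve as a kernel.\<close>

lemma FPK_operator_integrable:
  fixes a :: "real \<Rightarrow> real^'n \<Rightarrow> real^'n^'n" and b :: "real \<Rightarrow> real^'n \<Rightarrow> real^'n"
  assumes a: "(\<lambda>(t, x). a t x) \<in> borel_measurable (restrict_space borel {s..} \<Otimes>\<^sub>M borel)"
    and b: "(\<lambda>(t, x). b t x) \<in> borel_measurable (restrict_space borel {s..} \<Otimes>\<^sub>M borel)"
    and \<mu>: "\<mu> \<in> weak_curves s"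
    and fin: "\<forall>T>s.
      (\<integral>\<^sup>+t\<in>{s..T}. (\<integral>\<^sup>+x. ennreal (norm (a t x) + norm (b t x)) \<partial>\<mu> t) \<partial>lborel) < \<infinity>"
    and \<phi>: "\<phi> \<in> C2c" and t: "t \<ge> s"
  shows "AE \<tau> in lborel. \<tau> \<in> {s..t} \<longrightarrow> integrable (\<mu> \<tau>) (FPK_operator a b \<tau> \<phi>)"
    and "set_integrable lborel {s..t} (\<lambda>\<tau>. \<integral>x. FPK_operator a b \<tau> \<phi> x \<partial>\<mu> \<tau>)"
proof -
  let ?M = "restrict_space borel {s..} :: real measure"
  let ?h = "\<lambda>\<tau>. \<integral>\<^sup>+x. ennreal (norm (a \<tau> x) + norm (b \<tau> x)) \<partial>\<mu> \<tau>"
  let ?g = "\<lambda>\<tau>. \<integral>x. FPK_operator a b \<tau> \<phi> x \<partial>\<mu> \<tau>"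
  obtain K where K: "K \<ge> 0" "\<And>t x. \<bar>FPK_operator a b t \<phi> x\<bar> \<le> K * (norm (a t x) + norm (b t x))"
    using FPK_operator_bound[OF \<phi>] by metis
  note [measurable] = a b
  have kernel [measurable]: "\<mu> \<in> measurable ?M (subprob_algebra borel)"
    by (rule weak_curve_measurable[OF \<mu>])
  have op [measurable]: "(\<lambda>(t, x). FPK_operator a b t \<phi> x) \<in> borel_measurable (?M \<Otimes>\<^sub>M borel)"
    by (rule FPK_operator_measurable[OF a b \<phi>])
  have h: "?h \<in> borel_measurable ?M"
    by (rule nn_integral_measurable_subprob_algebra2[OF _ kernel]) measurable
  have g: "?g \<in> borel_measurable ?M"
    by (rule integral_kernel_measurable[OF op kernel])
  have sets: "sets (\<mu> \<tau>) = sets borel" if "\<tau> \<ge> s" for \<tau>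
    using \<mu> that by (auto simp: weak_curves_iff borel_probs_def)
  have slice: "(\<lambda>x. f \<tau> x) \<in> borel_measurable (\<mu> \<tau>)"
    if "(\<lambda>(t, x). f t x) \<in> borel_measurable (?M \<Otimes>\<^sub>M borel)" "\<tau> \<ge> s"
    for f :: "real \<Rightarrow> real^'n \<Rightarrow> 'c::topological_space" and \<tau>
  proof (rule borel_measurable_sets_eq[OF sets[OF \<open>\<tau> \<ge> s\<close>]])
    show "(\<lambda>x. f \<tau> x) \<in> borel_measurable borel"
      using measurable_Pair2[OF that(1), of \<tau>] that(2) by (simp add: space_restrict_space)
  qed
  have bound: "(\<integral>\<^sup>+x. ennreal (norm (FPK_operator a b \<tau> \<phi> x)) \<partial>\<mu> \<tau>) \<le> ennreal K * ?h \<tau>" if "\<tau> \<ge> s" for \<tau>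
  proof -
    have "(\<integral>\<^sup>+x. ennreal (norm (FPK_operator a b \<tau> \<phi> x)) \<partial>\<mu> \<tau>)
        \<le> (\<integral>\<^sup>+x. ennreal K * ennreal (norm (a \<tau> x) + norm (b \<tau> x)) \<partial>\<mu> \<tau>)"
      using K by (intro nn_integral_mono) (simp add: ennreal_mult[symmetric] ennreal_leI del: ennreal_plus)
    also have "\<dots> = ennreal K * ?h \<tau>"
      using slice[OF a that] slice[OF b that] by (intro nn_integral_cmult) simp
    finally show ?thesis .
  qed
  \<comment> \<open>The hypothesis \<open>fin\<close> needs an interval of positive length, and \<open>t = s\<close> is allowed;
    so the interval is enlarged to \<open>{s..t+1}\<close>.\<close>
  have hT: "(\<lambda>\<tau>. ?h \<tau> * indicator {s..t+1} \<tau>) \<in> borel_measurable lborel"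
    using measurable_restrict_mono[OF h, of "{s..t+1}"] by (simp add: borel_measurable_restrict_space_iff_ennreal)
  have hfin: "(\<integral>\<^sup>+\<tau>. ?h \<tau> * indicator {s..t+1} \<tau> \<partial>lborel) < \<infinity>"
    using fin t by (auto dest!: spec[of _ "t + 1"])
  have "AE \<tau> in lborel. ?h \<tau> * indicator {s..t+1} \<tau> \<noteq> \<infinity>"
    using hT hfin by (intro nn_integral_PInf_AE) auto
  then show "AE \<tau> in lborel. \<tau> \<in> {s..t} \<longrightarrow> integrable (\<mu> \<tau>) (FPK_operator a b \<tau> \<phi>)"
  proof eventually_elim
    case (elim \<tau>)
    show ?case
    proof
      assume \<tau>: "\<tau> \<in> {s..t}"
      with elim have "ennreal K * ?h \<tau> < \<infinity>"
        by (simp add: ennreal_mult_less_top less_top)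
      with bound[of \<tau>] \<tau> slice[OF op, of \<tau>] show "integrable (\<mu> \<tau>) (FPK_operator a b \<tau> \<phi>)"
        by (intro integrableI_bounded) auto
    qed
  qed
  show "set_integrable lborel {s..t} ?g"
    unfolding set_integrable_def
  proof (rule integrableI_bounded)
    show "(\<lambda>\<tau>. indicator {s..t} \<tau> *\<^sub>R ?g \<tau>) \<in> borel_measurable lborel"
      using measurable_restrict_mono[OF g, of "{s..t}"] by (simp add: borel_measurable_restrict_space_iff)
    have le: "ennreal (norm (?g \<tau>)) \<le> ennreal K * ?h \<tau>" if "\<tau> \<ge> s" for \<tau>
    proof (cases "integrable (\<mu> \<tau>) (FPK_operator a b \<tau> \<phi>)")
      case True
      then show ?thesis
        using integral_norm_bound_ennreal[OF True] bound[OF that] by (rule_tac order_trans)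
    qed (simp add: not_integrable_integral_eq)
    have "(\<integral>\<^sup>+\<tau>. ennreal (norm (indicator {s..t} \<tau> *\<^sub>R ?g \<tau>)) \<partial>lborel)
        \<le> (\<integral>\<^sup>+\<tau>. ennreal K * (?h \<tau> * indicator {s..t+1} \<tau>) \<partial>lborel)"
      using le by (intro nn_integral_mono) (auto split: split_indicator)
    also have "\<dots> = ennreal K * (\<integral>\<^sup>+\<tau>. ?h \<tau> * indicator {s..t+1} \<tau> \<partial>lborel)"
      by (rule nn_integral_cmult[OF hT])
    also have "\<dots> < \<infinity>" using hfin by (simp add: ennreal_mult_less_top)
    finally show "(\<integral>\<^sup>+\<tau>. ennreal (norm (indicator {s..t} \<tau> *\<^sub>R ?g \<tau>)) \<partial>lborel) < \<infinity>" .
  qed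
qed

section \<open>Splitting a solution\<close>

text \<open>All conditions defining a solution are affine in the curve. Weak continuity and the equation
  for \<open>\<nu> = (\<mu> - \<alpha>\<eta>) / (1 - \<alpha>)\<close> come from those of \<open>\<mu>\<close> and \<open>\<eta>\<close> by subtraction, and
  \<open>(1 - \<alpha>)\<nu> \<le> \<mu>\<close> bounds the integral of the coefficients.\<close>

lemma FPK_solution_remainder:
  fixes a :: "real \<Rightarrow> real^'n \<Rightarrow> real^'n^'n" and b :: "real \<Rightarrow> real^'n \<Rightarrow> real^'n"
  assumes a: "(\<lambda>(t, x). a t x) \<in> borel_measurable (restrict_space borel {s..} \<Otimes>\<^sub>M borel)"
    and b: "(\<lambda>(t, x). b t x) \<in> borel_measurable (restrict_space borel {s..} \<Otimes>\<^sub>M borel)"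
    and \<mu>: "\<mu> \<in> FPK_solutions a b s \<zeta>" and \<eta>: "\<eta> \<in> FPK_solutions a b s \<zeta>"
    and ext: "\<nu> \<in> extensional {s..}" and prob: "\<And>t. t \<ge> s \<Longrightarrow> prob_space (\<nu> t)"
    and mix: "\<And>t. t \<ge> s \<Longrightarrow> mixture \<alpha> (\<eta> t) (\<nu> t) (\<mu> t)"
  shows "\<nu> \<in> FPK_solutions a b s \<zeta>"
proof -
  let ?m = "\<lambda>\<kappa> \<tau>. \<integral>\<^sup>+x. ennreal (norm (a \<tau> x) + norm (b \<tau> x)) \<partial>\<kappa> \<tau>"
  let ?L = "\<lambda>\<kappa> \<phi> \<tau>. \<integral>x. FPK_operator a b \<tau> \<phi> x \<partial>\<kappa> \<tau>"
  have \<alpha>: "0 < \<alpha>" "\<alpha> < 1" using mix[of s] by (auto simp: mixture_def)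
  have \<mu>c: "\<mu> \<in> weak_curves s" and \<eta>c: "\<eta> \<in> weak_curves s"
    using \<mu> \<eta> by (auto simp: FPK_solutions_def)
  have \<mu>fin: "\<forall>T>s. (\<integral>\<^sup>+t\<in>{s..T}. ?m \<mu> t \<partial>lborel) < \<infinity>"
    and \<eta>fin: "\<forall>T>s. (\<integral>\<^sup>+t\<in>{s..T}. ?m \<eta> t \<partial>lborel) < \<infinity>"
    using \<mu> \<eta> by (auto simp: FPK_solutions_def)
  have \<mu>sp: "prob_space (\<mu> t)" "sets (\<mu> t) = sets borel" if "t \<ge> s" for t
    using \<mu>c that by (auto simp: weak_curves_iff borel_probs_def)
  have \<nu>sets: "sets (\<nu> t) = sets borel" if "t \<ge> s" for t
    using mix[OF that] \<mu>sp[OF that] by (auto simp: mixture_def)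
  have bounded_comb: "integral\<^sup>L (\<mu> t) f = \<alpha> * integral\<^sup>L (\<eta> t) f + (1 - \<alpha>) * integral\<^sup>L (\<nu> t) f"
    if t: "t \<ge> s" and f: "continuous_on UNIV f" "bounded (range f)" for t and f :: "real^'n \<Rightarrow> real"
  proof (rule integral_mixture(3)[OF mix[OF t]])
    interpret prob_space "\<mu> t" by (rule \<mu>sp[OF t])
    obtain B where "\<And>x. norm (f x) \<le> B" using f(2) by (auto simp: bounded_iff)
    then show "integrable (\<mu> t) f"
      using f(1) \<mu>sp[OF t]
      by (intro integrable_const_bound[of _ B] borel_measurable_sets_eq[OF \<mu>sp(2)[OF t]] borel_measurable_continuous_onI) auto
  qed
  have \<nu>c: "\<nu> \<in> weak_curves s"
    unfolding weak_curves_iff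
  proof (intro conjI allI impI)
    fix f :: "real^'n \<Rightarrow> real" assume f: "continuous_on UNIV f" "bounded (range f)"
    have "continuous_on {s..} (\<lambda>t. (integral\<^sup>L (\<mu> t) f - \<alpha> * integral\<^sup>L (\<eta> t) f) / (1 - \<alpha>))"
      using \<mu>c \<eta>c f \<alpha> by (intro continuous_intros) (auto simp: weak_curves_iff)
    moreover have "(integral\<^sup>L (\<mu> t) f - \<alpha> * integral\<^sup>L (\<eta> t) f) / (1 - \<alpha>) = integral\<^sup>L (\<nu> t) f"
      if "t \<in> {s..}" for t
      using bounded_comb[of t f] that f \<alpha> by simp
    ultimately show "continuous_on {s..} (\<lambda>t. integral\<^sup>L (\<nu> t) f)"
      by (subst (asm) continuous_on_cong[OF refl]) auto
  qed (use ext prob \<nu>sets in \<open>auto simp: borel_probs_def\<close>)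
  have mass: "ennreal (1 - \<alpha>) * ?m \<nu> t \<le> ?m \<mu> t" if t: "t \<ge> s" for t
  proof -
    have "(\<lambda>x. ennreal (norm (a t x) + norm (b t x))) \<in> borel_measurable (\<mu> t)"
    proof (rule borel_measurable_sets_eq[OF \<mu>sp(2)[OF t]])
      have "a t \<in> borel_measurable borel" "b t \<in> borel_measurable borel"
        using measurable_Pair2[OF a, of t] measurable_Pair2[OF b, of t] t by (simp_all add: space_restrict_space)
      then show "(\<lambda>x. ennreal (norm (a t x) + norm (b t x))) \<in> borel_measurable borel" by measurable
    qed
    from nn_integral_mixture[OF mix[OF t] this] show ?thesis by simp
  qed
  have \<nu>fin: "\<forall>T>s. (\<integral>\<^sup>+t\<in>{s..T}. ?m \<nu> t \<partial>lborel) < \<infinity>"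
  proof (intro allI impI)
    fix T assume T: "T > s"
    note [measurable] = a b
    have "(\<lambda>t. ?m \<nu> t) \<in> borel_measurable (restrict_space borel {s..})"
      by (intro nn_integral_measurable_subprob_algebra2[OF _ weak_curve_measurable[OF \<nu>c]]) measurable
    then have meas: "(\<lambda>t. ?m \<nu> t * indicator {s..T} t) \<in> borel_measurable lborel"
      using measurable_restrict_mono[of "?m \<nu>" borel "{s..}" borel "{s..T}"]
      by (simp add: borel_measurable_restrict_space_iff_ennreal)
    have "ennreal (1 - \<alpha>) * (\<integral>\<^sup>+t\<in>{s..T}. ?m \<nu> t \<partial>lborel)
        = (\<integral>\<^sup>+t. ennreal (1 - \<alpha>) * (?m \<nu> t * indicator {s..T} t) \<partial>lborel)"
      using meas by (rule nn_integral_cmult[symmetric])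
    also have "\<dots> \<le> (\<integral>\<^sup>+t\<in>{s..T}. ?m \<mu> t \<partial>lborel)"
      using mass by (intro nn_integral_mono) (auto split: split_indicator)
    also have "\<dots> < \<infinity>" using \<mu>fin T by blast
    finally show "(\<integral>\<^sup>+t\<in>{s..T}. ?m \<nu> t \<partial>lborel) < \<infinity>"
      using \<alpha> by (auto simp: ennreal_mult_less_top less_top[symmetric])
  qed
  show ?thesis
    unfolding FPK_solutions_def
  proof (intro CollectI conjI allI impI ballI)
    fix \<phi> :: "real^'n \<Rightarrow> real" and t assume \<phi>: "\<phi> \<in> C2c" and t: "t \<ge> s"
    note \<mu>int = FPK_operator_integrable[OF a b \<mu>c \<mu>fin \<phi> t]
      and \<eta>int = FPK_operator_integrable(2)[OF a b \<eta>c \<eta>fin \<phi> t]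
      and \<nu>int = FPK_operator_integrable(2)[OF a b \<nu>c \<nu>fin \<phi> t]
    have "(LINT \<tau>:{s..t}|lborel. ?L \<mu> \<phi> \<tau>)
        = (LINT \<tau>:{s..t}|lborel. \<alpha> * ?L \<eta> \<phi> \<tau> + (1 - \<alpha>) * ?L \<nu> \<phi> \<tau>)"
      unfolding set_lebesgue_integral_def
    proof (rule integral_cong_AE)
      show "(\<lambda>\<tau>. indicat_real {s..t} \<tau> *\<^sub>R ?L \<mu> \<phi> \<tau>) \<in> borel_measurable lborel"
        using \<mu>int(2) unfolding set_integrable_def by (rule borel_measurable_integrable)
      have "set_integrable lborel {s..t} (\<lambda>\<tau>. \<alpha> * ?L \<eta> \<phi> \<tau> + (1 - \<alpha>) * ?L \<nu> \<phi> \<tau>)"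
        using \<eta>int \<nu>int by (intro set_integral_add set_integrable_mult_right)
      then show "(\<lambda>\<tau>. indicat_real {s..t} \<tau> *\<^sub>R (\<alpha> * ?L \<eta> \<phi> \<tau> + (1 - \<alpha>) * ?L \<nu> \<phi> \<tau>)) \<in> borel_measurable lborel"
        unfolding set_integrable_def by (rule borel_measurable_integrable)
      show "AE \<tau> in lborel. indicat_real {s..t} \<tau> *\<^sub>R ?L \<mu> \<phi> \<tau> =
          indicat_real {s..t} \<tau> *\<^sub>R (\<alpha> * ?L \<eta> \<phi> \<tau> + (1 - \<alpha>) * ?L \<nu> \<phi> \<tau>)"
        using \<mu>int(1)
      proof eventually_elim
        case (elim \<tau>)
        then show ?case
          using integral_mixture(3)[OF mix[of \<tau>], of "FPK_operator a b \<tau> \<phi>"]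
          by (auto split: split_indicator)
      qed
    qed
    also have "\<dots> = \<alpha> * (LINT \<tau>:{s..t}|lborel. ?L \<eta> \<phi> \<tau>) + (1 - \<alpha>) * (LINT \<tau>:{s..t}|lborel. ?L \<nu> \<phi> \<tau>)"
      using \<eta>int \<nu>int by (subst set_integral_add) auto
    finally have rhs: "(LINT \<tau>:{s..t}|lborel. ?L \<mu> \<phi> \<tau>) = \<dots>" .
    have "continuous_on UNIV \<phi>" using \<phi> by (auto simp: C2c_def intro: differentiable_imp_continuous_on)
    moreover have "bounded (range \<phi>)"
      using C2c_bounded_derivatives[OF \<phi>] by (metis (no_types, lifting) boundedI rangeE real_norm_def)
    ultimately have lhs: "integral\<^sup>L (\<mu> t) \<phi> = \<alpha> * integral\<^sup>L (\<eta> t) \<phi> + (1 - \<alpha>) * integral\<^sup>L (\<nu> t) \<phi>"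
      by (rule bounded_comb[OF t])
    have "integral\<^sup>L (\<mu> t) \<phi> - integral\<^sup>L \<zeta> \<phi> = (LINT \<tau>:{s..t}|lborel. ?L \<mu> \<phi> \<tau>)"
      "integral\<^sup>L (\<eta> t) \<phi> - integral\<^sup>L \<zeta> \<phi> = (LINT \<tau>:{s..t}|lborel. ?L \<eta> \<phi> \<tau>)"
      using \<mu> \<eta> \<phi> t by (auto simp: FPK_solutions_def)
    then have "(1 - \<alpha>) * (integral\<^sup>L (\<nu> t) \<phi> - integral\<^sup>L \<zeta> \<phi>) = (1 - \<alpha>) * (LINT \<tau>:{s..t}|lborel. ?L \<nu> \<phi> \<tau>)"
      using lhs rhs by (simp add: algebra_simps)
    then show "integral\<^sup>L (\<nu> t) \<phi> - integral\<^sup>L \<zeta> \<phi> = (LINT \<tau>:{s..t}|lborel. ?L \<nu> \<phi> \<tau>)"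
      using \<alpha> by simp
  qed (use \<nu>c \<nu>fin in auto)
qed

text \<open>The measures are finite, so the inequality between extended nonnegative values is one between
  real numbers.\<close>

lemma dominated_iff:
  assumes \<mu>: "\<mu> \<in> weak_curves s" and \<eta>: "\<eta> \<in> weak_curves s"
  shows "\<eta> \<in> dominated s \<mu> \<longleftrightarrow> (\<exists>C>0. \<forall>t\<ge>s. \<forall>A\<in>sets borel. measure (\<eta> t) A \<le> C * measure (\<mu> t) A)"
proof -
  have "\<eta> t \<le> scale_measure (ennreal C) (\<mu> t) \<longleftrightarrow> (\<forall>A\<in>sets borel. measure (\<eta> t) A \<le> C * measure (\<mu> t) A)"
    if "t \<ge> s" "C > 0" for t C
  proof -
    have sets: "sets (\<mu> t) = sets borel" "sets (\<eta> t) = sets borel"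
      and prob: "prob_space (\<mu> t)" "prob_space (\<eta> t)"
      using \<mu> \<eta> that by (auto simp: weak_curves_iff borel_probs_def)
    interpret M: prob_space "\<mu> t" by (rule prob)
    interpret E: prob_space "\<eta> t" by (rule prob)
    show ?thesis
      using that by (subst le_measure) (auto simp: sets M.emeasure_eq_measure E.emeasure_eq_measure ennreal_mult[symmetric])
  qed
  then show ?thesis using \<eta> by (auto simp: dominated_def dominated_by_def)
qed

theorem lemma3p5:
  fixes a \<sigma> :: "real \<Rightarrow> real^'n \<Rightarrow> real^'n^'n"
    and b :: "real \<Rightarrow> real^'n \<Rightarrow> real^'n"
    and s :: real
    and \<zeta> :: "(real^'n) measure"
    and \<mu> :: "real \<Rightarrow> (real^'n) measure"
  assumes a_borel: "(\<lambda>(t, x). a t x) \<in> borel_measurable (restrict_space borel ({0..} \<times> UNIV))"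
    and b_borel: "(\<lambda>(t, x). b t x) \<in> borel_measurable (restrict_space borel ({0..} \<times> UNIV))"
    and \<sigma>_borel: "(\<lambda>(t, x). \<sigma> t x) \<in> borel_measurable (restrict_space borel ({0..} \<times> UNIV))"
    and a_eq: "\<And>t x. t \<ge> 0 \<Longrightarrow> a t x = (1/2) *\<^sub>R (\<sigma> t x ** transpose (\<sigma> t x))"
    and s: "s \<ge> 0"
    and \<zeta>: "\<zeta> \<in> borel_probs"
    and \<mu>: "\<mu> \<in> FPK_solutions a b s \<zeta>"
  shows "card (FPK_solutions a b s \<zeta> \<inter> dominated s \<mu>) = 1 \<longleftrightarrow> \<mu> \<in> FPK_extremal a b s \<zeta>"
proof
  let ?S = "FPK_solutions a b s \<zeta>"
  have curve: "\<kappa> \<in> weak_curves s" if "\<kappa> \<in> ?S" for \<kappa>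
    using that by (simp add: FPK_solutions_def)
  show "\<mu> \<in> FPK_extremal a b s \<zeta>" if "card (?S \<inter> dominated s \<mu>) = 1"
    unfolding FPK_extremal_def
  proof (intro CollectI conjI ballI impI \<mu>)
    fix \<alpha> \<mu>1 \<mu>2
    assume \<alpha>: "\<alpha> \<in> {0<..<1::real}" and sol: "\<mu>1 \<in> ?S" "\<mu>2 \<in> ?S"
      and comb: "curve_convex_comb s \<alpha> \<mu>1 \<mu>2 \<mu>"
    have "measure (\<mu>1 t) A \<le> (1 / \<alpha>) * measure (\<mu> t) A"
      and "measure (\<mu>2 t) A \<le> (1 / (1 - \<alpha>)) * measure (\<mu> t) A" if "t \<ge> s" "A \<in> sets borel" for t A
    proof -
      have "measure (\<mu> t) A = \<alpha> * measure (\<mu>1 t) A + (1 - \<alpha>) * measure (\<mu>2 t) A"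
        using comb that by (simp add: curve_convex_comb_def)
      moreover have "0 \<le> \<alpha> * measure (\<mu>1 t) A" "0 \<le> (1 - \<alpha>) * measure (\<mu>2 t) A"
        using \<alpha> by auto
      ultimately have "\<alpha> * measure (\<mu>1 t) A \<le> measure (\<mu> t) A"
        "(1 - \<alpha>) * measure (\<mu>2 t) A \<le> measure (\<mu> t) A"
        by linarith+
      then show "measure (\<mu>1 t) A \<le> (1 / \<alpha>) * measure (\<mu> t) A"
        and "measure (\<mu>2 t) A \<le> (1 / (1 - \<alpha>)) * measure (\<mu> t) A"
        using \<alpha> by (simp_all add: pos_le_divide_eq mult.commute)
    qed
    moreover have "1 / \<alpha> > 0" "1 / (1 - \<alpha>) > 0" using \<alpha> by auto
    ultimately have "\<mu>1 \<in> dominated s \<mu>" "\<mu>2 \<in> dominated s \<mu>"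
      using dominated_iff[OF curve[OF \<mu>]] curve sol by meson+
    with sol that show "\<mu>1 = \<mu>2" by (metis IntI card_1_singletonE singletonD)
  qed
next
  let ?S = "FPK_solutions a b s \<zeta>"
  have curve: "\<kappa> \<in> weak_curves s" if "\<kappa> \<in> ?S" for \<kappa>
    using that by (simp add: FPK_solutions_def)
  assume extremal: "\<mu> \<in> FPK_extremal a b s \<zeta>"
  have "\<eta> = \<mu>" if \<eta>: "\<eta> \<in> ?S" and dom: "\<eta> \<in> dominated s \<mu>" for \<eta>
  proof -
    obtain C0 where C0: "C0 > 0" "\<And>t A. t \<ge> s \<Longrightarrow> A \<in> sets borel \<Longrightarrow> measure (\<eta> t) A \<le> C0 * measure (\<mu> t) A"
      using dom dominated_iff[OF curve[OF \<mu>] curve[OF \<eta>]] by blast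
    \<comment> \<open>The weight \<open>1 / C\<close> must be below \<open>1\<close>, so the constant is enlarged.\<close>
    define C where "C = C0 + 1"
    have C: "C > 1" using C0 by (simp add: C_def)
    have prob: "prob_space (\<mu> t)" "prob_space (\<eta> t)" and sets: "sets (\<mu> t) = sets borel" "sets (\<eta> t) = sets borel"
      if "t \<ge> s" for t
      using curve[OF \<mu>] curve[OF \<eta>] that by (auto simp: weak_curves_iff borel_probs_def)
    have "\<exists>R. prob_space R \<and> mixture (1 / C) (\<eta> t) R (\<mu> t)" if t: "t \<ge> s" for t
    proof -
      interpret M: prob_space "\<mu> t" by (rule prob[OF t])
      interpret E: prob_space "\<eta> t" by (rule prob[OF t])
      have "emeasure (\<eta> t) A \<le> ennreal C * emeasure (\<mu> t) A" if "A \<in> sets (\<mu> t)" for A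
      proof -
        have "measure (\<eta> t) A \<le> C * measure (\<mu> t) A"
          using C0(2)[OF t, of A] that sets[OF t]
          by (simp add: C_def distrib_right add_increasing2)
        then show ?thesis
          using C by (simp add: M.emeasure_eq_measure E.emeasure_eq_measure ennreal_mult[symmetric] ennreal_leI)
      qed
      then show ?thesis
        using mixture_remainder_exists[OF prob[OF t] _ C] sets[OF t] by metis
    qed
    then obtain R where R: "\<And>t. t \<ge> s \<Longrightarrow> prob_space (R t) \<and> mixture (1 / C) (\<eta> t) (R t) (\<mu> t)"
      by metis
    define \<nu> where "\<nu> = restrict R {s..}"
    have \<nu>: "prob_space (\<nu> t)" "mixture (1 / C) (\<eta> t) (\<nu> t) (\<mu> t)" if "t \<ge> s" for t
      using R[OF that] that by (simp_all add: \<nu>_def)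
    have "\<nu> \<in> ?S"
      by (rule FPK_solution_remainder[OF measurable_on_time_strip[OF a_borel s]
            measurable_on_time_strip[OF b_borel s] \<mu> \<eta> _ \<nu>]) (simp_all add: \<nu>_def extensional_def)
    moreover have "curve_convex_comb s (1 / C) \<eta> \<nu> \<mu>"
      unfolding curve_convex_comb_def
    proof (intro allI impI ballI)
      fix t A assume t: "t \<ge> s" and A: "A \<in> sets (borel :: (real^'n) measure)"
      interpret M: prob_space "\<mu> t" by (rule prob[OF t])
      show "measure (\<mu> t) A = 1 / C * measure (\<eta> t) A + (1 - 1 / C) * measure (\<nu> t) A"
        using measure_mixture[OF \<nu>(2)[OF t] M.finite_measure_axioms, of A] A sets[OF t] by simp
    qed
    moreover have "1 / C \<in> {0<..<1}" using C by simp
    ultimately have "\<eta> = \<nu>"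
      using extremal \<eta> unfolding FPK_extremal_def by blast
    \<comment> \<open>A mixture of \<open>\<eta>\<close> with itself is \<open>\<eta>\<close>.\<close>
    have "\<eta> t = \<mu> t" if t: "t \<ge> s" for t
    proof (rule measure_eqI)
      fix A assume "A \<in> sets (\<eta> t)"
      then have "emeasure (\<mu> t) A = (ennreal (1 / C) + ennreal (1 - 1 / C)) * emeasure (\<eta> t) A"
        using \<nu>(2)[OF t] \<open>\<eta> = \<nu>\<close> by (simp add: mixture_def distrib_right)
      also have "ennreal (1 / C) + ennreal (1 - 1 / C) = 1"
        using C by (simp add: ennreal_plus[symmetric] del: ennreal_plus)
      finally show "emeasure (\<eta> t) A = emeasure (\<mu> t) A" by simp
    qed (simp add: sets[OF t])
    then show ?thesis
      using curve[OF \<mu>] curve[OF \<eta>] by (auto simp: weak_curves_iff intro!: extensionalityI)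
  qed
  moreover have "\<mu> \<in> dominated s \<mu>"
    unfolding dominated_iff[OF curve[OF \<mu>] curve[OF \<mu>]] by (intro exI[of _ 1]) simp
  ultimately have "?S \<inter> dominated s \<mu> = {\<mu>}" using \<mu> by blast
  then show "card (?S \<inter> dominated s \<mu>) = 1" by simp
qed

end
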